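(* The iterated $\mathcal A$-evolvents of an equiangular hedgehog with zero perimeter converge to its vertex centroid. That is, if $\mathbf Q_0$ is an equiangular hedgehog with $n\ge3$ sides and zero perimeter and $\mathbf Q_{k+1}$ is the $\mathcal A$-evolvent of $\mathbf Q_k$, then all vertices of $\mathbf Q_k$ converge, as $k\to\infty$, to the vertex centroid of $\mathbf Q_0$.
   Context: A cooriented line $(\alpha,p)$ is the line $x\cos\alpha+y\sin\alpha=p$ with coorienting normal $(\cos\alpha,\sin\alpha)$; it is oriented by the normal turned counterclockwise by $\pi/2$ (and conversely). A cooriented $n$-gon is a cyclic sequence of cooriented lines $l_j=(\alpha_j,p_j)$ (indices mod $n$) with $l_j,l_{j+1}$ meeting at a single vertex $P_{j+\frac12}$. It is an equiangular hedgehog if $\alpha_{j+1}-\alpha_j\equiv2\pi/n\pmod{2\pi}$ for all $j$. The signed length $\ell_j$ of the $j$-th side is the distance from $P_{j-\frac12}$ to $P_{j+\frac12}$, with negative sign if the order of the vertices disagrees with the orientation of $l_j$; the perimeter is $\sum_j\ell_j$ (for equiangular hedgehogs it vanishes iff $\sum_jp_j=0$). The vertex centroid is the arithmetic mean of the $n$ vertices. If $l,l'$ are crossing oriented lines with orienting unit vectors $e,e'$, the interior bisector of $\angle(l,l')$ is the line through their intersection point oriented by $e'-e$. The oriented angle bisector evolute $\mathcal A_o(\mathbf P)$ of $\mathbf P=(l_1,\dots,l_n)$ is the cooriented polygon formed by the interior bisectors of $\angle(l_j,l_{j+1})$, $j=1,\dots,n$; for an equiangular hedgehog its $j$-th side has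 coordinates $\left(\alpha_j+\frac\pi n+\frac\pi2,\ \frac{p_{j+1}-p_j}{2\sin(\pi/n)}\right)$. The $\mathcal A$-evolvent of an equiangular hedgehog $\mathbf Q$ of zero perimeter is the unique equiangular hedgehog of zero perimeter whose $\mathcal A_o$-evolute is $\mathbf Q$. *)

theory Defs
  imports "HOL-Analysis.Analysis" "HOL-Library.Real_Mod"
begin

text \<open>
  The Euclidean plane is identified with \<^typ>\<open>complex\<close>, so that
  \<open>cis \<alpha>\<close> is the unit vector \<open>(cos \<alpha>, sin \<alpha>)\<close> and multiplication by \<^term>\<open>\<i>\<close> is the
  counterclockwise turn by \<open>\<pi>/2\<close>. In a cooriented line \<open>(\<alpha>, p)\<close> the angle matters
  only modulo \<open>2\<pi>\<close>, so that equality on the quotient type is equality of cooriented lines.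
\<close>

quotient_type coline = "real \<times> real" /
  "\<lambda>(\<alpha>, p) (\<beta>, q). [\<alpha> = \<beta>] (rmod (2 * pi)) \<and> p = q"
  by (auto intro!: equivpI reflpI sympI transpI simp: rcong_def)

lift_definition Coline :: "real \<Rightarrow> real \<Rightarrow> coline" is "\<lambda>\<alpha> p. (\<alpha>, p)" .

lift_definition conormal :: "coline \<Rightarrow> complex" is "\<lambda>(\<alpha>, p). cis \<alpha>"
  by (auto simp: cis_eq_iff)

lift_definition offset :: "coline \<Rightarrow> real" is "\<lambda>(\<alpha>, p). p"
  by auto

definition line_points :: "coline \<Rightarrow> complex set" where
  "line_points l = {z. Re z * Re (conormal l) + Im z * Im (conormal l) = offset l}"

definition orient :: "coline \<Rightarrow> complex" where
  "orient l = \<i> * conormal l"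

lift_definition turns_by :: "real \<Rightarrow> coline \<Rightarrow> coline \<Rightarrow> bool" is
  "\<lambda>\<theta> (\<alpha>, p) (\<beta>, q). [\<beta> - \<alpha> = \<theta>] (rmod (2 * pi))"
  by (auto simp flip: cis_eq_iff cis_divide)

definition crossing :: "coline \<Rightarrow> coline \<Rightarrow> bool" where
  "crossing l l' \<longleftrightarrow> (\<exists>!z. z \<in> line_points l \<and> z \<in> line_points l')"

definition meet :: "coline \<Rightarrow> coline \<Rightarrow> complex" where
  "meet l l' = (THE z. z \<in> line_points l \<and> z \<in> line_points l')"

text \<open>
  A cyclic sequence indexed modulo \<open>n\<close> is an \<open>n\<close>-periodic function on the integers;
  \<open>vertex P j\<close> is the vertex with half-integer index \<open>j + 1/2\<close>.
\<close>

definition cooriented_polygon :: "nat \<Rightarrow> (int \<Rightarrow> coline) \<Rightarrow> bool" where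
  "cooriented_polygon n P \<longleftrightarrow>
     (\<forall>j. P (j + int n) = P j) \<and> (\<forall>j. crossing (P j) (P (j + 1)))"

definition vertex :: "(int \<Rightarrow> coline) \<Rightarrow> int \<Rightarrow> complex" where
  "vertex P j = meet (P j) (P (j + 1))"

definition equiangular_hedgehog :: "nat \<Rightarrow> (int \<Rightarrow> coline) \<Rightarrow> bool" where
  "equiangular_hedgehog n P \<longleftrightarrow>
     cooriented_polygon n P \<and> (\<forall>j. turns_by (2 * pi / real n) (P j) (P (j + 1)))"

definition signed_length :: "(int \<Rightarrow> coline) \<Rightarrow> int \<Rightarrow> real" where
  "signed_length P j =
     (if inner (vertex P j - vertex P (j - 1)) (orient (P j)) < 0
      then - dist (vertex P (j - 1)) (vertex P j)
      else dist (vertex P (j - 1)) (vertex P j))"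

definition perimeter :: "nat \<Rightarrow> (int \<Rightarrow> coline) \<Rightarrow> real" where
  "perimeter n P = (\<Sum>j = 0..<int n. signed_length P j)"

definition vertex_centroid :: "nat \<Rightarrow> (int \<Rightarrow> coline) \<Rightarrow> complex" where
  "vertex_centroid n P = (\<Sum>j = 0..<int n. vertex P j) / of_nat n"

text \<open>The vector \<open>e' - e\<close> is nonzero for crossing lines but is not a unit vector, hence \<^const>\<open>sgn\<close>.\<close>

definition interior_bisector :: "coline \<Rightarrow> coline \<Rightarrow> coline" where
  "interior_bisector l l' =
     (THE b. meet l l' \<in> line_points b \<and> orient b = sgn (orient l' - orient l))"

definition A_evolute :: "(int \<Rightarrow> coline) \<Rightarrow> int \<Rightarrow> coline" where
  "A_evolute P j = interior_bisector (P j) (P (j + 1))"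

definition A_evolvent :: "nat \<Rightarrow> (int \<Rightarrow> coline) \<Rightarrow> int \<Rightarrow> coline" where
  "A_evolvent n Q =
     (THE P. equiangular_hedgehog n P \<and> perimeter n P = 0 \<and> A_evolute P = Q)"


text \<open>
  The descriptions above are justified below: bisectors have the expected coordinates, and
  the evolvent of an equiangular hedgehog of zero perimeter exists and is unique.
\<close>

lemma Coline_eq_iff: "Coline \<alpha> p = Coline \<beta> q \<longleftrightarrow> [\<alpha> = \<beta>] (rmod (2 * pi)) \<and> p = q"
  by transfer auto

lemma Coline_cases: obtains \<alpha> p where "l = Coline \<alpha> p"
  by (transfer fixing: thesis) auto

lemma conormal_Coline [simp]: "conormal (Coline \<alpha> p) = cis \<alpha>"
  by transfer simp

lemma offset_Coline [simp]: "offset (Coline \<alpha> p) = p"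
  by transfer simp

lemma turns_by_Coline: "turns_by \<theta> (Coline \<alpha> p) (Coline \<beta> q) \<longleftrightarrow> [\<beta> - \<alpha> = \<theta>] (rmod (2 * pi))"
  by transfer simp

lemma coline_eqI: "conormal l = conormal l' \<Longrightarrow> offset l = offset l' \<Longrightarrow> l = l'"
  by (metis Coline_cases Coline_eq_iff cis_eq_iff conormal_Coline offset_Coline)

lemma line_points_Coline:
  "z \<in> line_points (Coline \<alpha> p) \<longleftrightarrow> Re z * cos \<alpha> + Im z * sin \<alpha> = p"
  by (simp add: line_points_def)

lemma line_points_Coline_iff:
  "z \<in> line_points (Coline \<alpha> p) \<longleftrightarrow> (\<exists>t. z = cis \<alpha> * Complex p t)"
proof
  assume z: "z \<in> line_points (Coline \<alpha> p)"
  have "z = cis \<alpha> * (cis (- \<alpha>) * z)"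
    by (simp add: mult.assoc[symmetric] cis_mult)
  moreover have "cis (- \<alpha>) * z = Complex p (Im (cis (- \<alpha>) * z))"
    using z by (simp add: line_points_Coline complex_eq_iff algebra_simps)
  ultimately show "\<exists>t. z = cis \<alpha> * Complex p t" by metis
next
  assume "\<exists>t. z = cis \<alpha> * Complex p t"
  then obtain t where z: "z = cis \<alpha> * Complex p t" by auto
  have "Re z * cos \<alpha> + Im z * sin \<alpha> = p * ((cos \<alpha>)\<^sup>2 + (sin \<alpha>)\<^sup>2)"
    by (simp add: z algebra_simps power2_eq_square
        del: sin_cos_squared_add sin_cos_squared_add2 sin_cos_squared_add3)
  thus "z \<in> line_points (Coline \<alpha> p)"
    by (simp add: line_points_Coline)
qed

lemma meet_unique_aux:
  assumes "sin \<theta> \<noteq> 0"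
  shows "z \<in> line_points (Coline \<alpha> p) \<and> z \<in> line_points (Coline (\<alpha> + \<theta>) q) \<longleftrightarrow>
           z = cis \<alpha> * Complex p ((q - p * cos \<theta>) / sin \<theta>)"
proof -
  have *: "cis \<alpha> * Complex p t \<in> line_points (Coline (\<alpha> + \<theta>) q) \<longleftrightarrow>
            t = (q - p * cos \<theta>) / sin \<theta>" for t
  proof -
    have "Re (cis \<alpha> * Complex p t) * cos (\<alpha> + \<theta>) + Im (cis \<alpha> * Complex p t) * sin (\<alpha> + \<theta>) =
          (p * cos \<theta> + t * sin \<theta>) * ((cos \<alpha>)\<^sup>2 + (sin \<alpha>)\<^sup>2)"
      by (simp add: cos_add sin_add algebra_simps power2_eq_square
          del: sin_cos_squared_add sin_cos_squared_add2 sin_cos_squared_add3)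
    thus ?thesis
      using assms by (auto simp: line_points_Coline field_simps)
  qed
  show ?thesis
    using * by (auto simp: line_points_Coline_iff[of z \<alpha>])
qed

lemma
  assumes "sin \<theta> \<noteq> 0"
  shows crossing_Coline: "crossing (Coline \<alpha> p) (Coline (\<alpha> + \<theta>) q)"
    and meet_Coline: "meet (Coline \<alpha> p) (Coline (\<alpha> + \<theta>) q) =
                        cis \<alpha> * Complex p ((q - p * cos \<theta>) / sin \<theta>)"
  unfolding crossing_def meet_def meet_unique_aux[OF assms] by simp_all

lemma interior_bisector_Coline:
  assumes "0 < \<theta>" "\<theta> < pi"
  shows "interior_bisector (Coline \<alpha> p) (Coline (\<alpha> + \<theta>) q) =
           Coline (\<alpha> + \<theta> / 2 + pi / 2) ((q - p) / (2 * sin (\<theta> / 2)))"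
proof -
  define s c where "s = sin (\<theta> / 2)" and "c = cos (\<theta> / 2)"
  have s: "s > 0" using assms by (auto simp: s_def intro: sin_gt_zero)
  have c: "c > 0" using assms by (auto simp: c_def intro: cos_gt_zero)
  have sc: "c * c = 1 - s * s"
    using sin_cos_squared_add[of "\<theta> / 2"] by (simp add: s_def c_def power2_eq_square)
  have th: "sin \<theta> = 2 * s * c" "cos \<theta> = 1 - 2 * s * s"
    using sin_double[of "\<theta> / 2"] cos_double_sin[of "\<theta> / 2"]
    by (simp_all add: s_def c_def power2_eq_square)
  have "sin \<theta> \<noteq> 0" using s c th by simp
  note m = meet_Coline[OF this, of \<alpha> p q]
  let ?b = "Coline (\<alpha> + \<theta> / 2 + pi / 2) ((q - p) / (2 * s))"
  have "orient (Coline (\<alpha> + \<theta>) q) - orient (Coline \<alpha> p) = of_real (2 * s) * (- cis (\<alpha> + \<theta> / 2))"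
  proof -
    have e: "\<alpha> + \<theta> = (\<alpha> + \<theta> / 2) + \<theta> / 2" by simp
    have "cis (\<alpha> + \<theta>) = cis (\<alpha> + \<theta> / 2) * cis (\<theta> / 2)" by (subst e, subst cis_mult) simp
    moreover have "cis \<alpha> = cis (\<alpha> + \<theta> / 2) * cis (- (\<theta> / 2))" by (subst cis_mult) simp
    ultimately have "orient (Coline (\<alpha> + \<theta>) q) - orient (Coline \<alpha> p) =
        \<i> * cis (\<alpha> + \<theta> / 2) * (cis (\<theta> / 2) - cis (- (\<theta> / 2)))"
      by (simp add: orient_def algebra_simps)
    also have "cis (\<theta> / 2) - cis (- (\<theta> / 2)) = 2 * \<i> * of_real s"
      by (simp add: complex_eq_iff s_def)
    finally show ?thesis by (simp add: algebra_simps)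
  qed
  hence "sgn (orient (Coline (\<alpha> + \<theta>) q) - orient (Coline \<alpha> p)) = - cis (\<alpha> + \<theta> / 2)"
    using s by (simp only: sgn_mult sgn_of_real) (simp add: sgn_minus)
  moreover have ob: "orient ?b = - cis (\<alpha> + \<theta> / 2)"
    by (simp add: orient_def complex_eq_iff sin_add cos_add)
  ultimately have or: "sgn (orient (Coline (\<alpha> + \<theta>) q) - orient (Coline \<alpha> p)) = orient ?b"
    by simp
  let ?t = "(q - p * cos \<theta>) / sin \<theta>"
  have on: "meet (Coline \<alpha> p) (Coline (\<alpha> + \<theta>) q) \<in> line_points ?b"
  proof -
    have "Re (cis \<alpha> * Complex p t) * cos (\<alpha> + \<theta> / 2 + pi / 2) +
          Im (cis \<alpha> * Complex p t) * sin (\<alpha> + \<theta> / 2 + pi / 2) =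
          (t * c - p * s) * ((cos \<alpha>)\<^sup>2 + (sin \<alpha>)\<^sup>2)" for t
      by (simp add: cos_add sin_add algebra_simps power2_eq_square s_def c_def
          del: sin_cos_squared_add sin_cos_squared_add2 sin_cos_squared_add3)
    from this[of ?t] have "Re (cis \<alpha> * Complex p ?t) * cos (\<alpha> + \<theta> / 2 + pi / 2) +
          Im (cis \<alpha> * Complex p ?t) * sin (\<alpha> + \<theta> / 2 + pi / 2) = ?t * c - p * s"
      by (simp only: sin_cos_squared_add2 mult_1_right)
    also have "\<dots> = (q - p) / (2 * s)"
    proof -
      have "?t * c = (q - p * (1 - 2 * s * s)) / (2 * s)"
        using s c by (simp add: th)
      thus ?thesis
        using s by (simp add: field_simps)
    qed
    finally show ?thesis
      by (simp add: m line_points_Coline)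
  qed
  have "interior_bisector (Coline \<alpha> p) (Coline (\<alpha> + \<theta>) q) = ?b"
    unfolding interior_bisector_def or
  proof (rule the_equality)
    show "meet (Coline \<alpha> p) (Coline (\<alpha> + \<theta>) q) \<in> line_points ?b \<and> orient ?b = orient ?b"
      using on by simp
  next
    fix b assume b: "meet (Coline \<alpha> p) (Coline (\<alpha> + \<theta>) q) \<in> line_points b \<and> orient b = orient ?b"
    hence "conormal b = conormal ?b" by (simp add: orient_def)
    with b on show "b = ?b" by (auto intro!: coline_eqI simp: line_points_def)
  qed
  thus ?thesis by (simp add: s_def)
qed

lemma equiangular_rep:
  assumes "equiangular_hedgehog n P"
  obtains \<alpha> where "\<And>j. P j = Coline (\<alpha> + of_int j * (2 * pi / real n)) (offset (P j))"
proof -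
  obtain \<alpha> p where P0: "P 0 = Coline \<alpha> p" by (rule Coline_cases)
  have step: "conormal (P (j + 1)) = conormal (P j) * cis (2 * pi / real n)" for j
  proof -
    obtain a p b q where ab: "P j = Coline a p" "P (j + 1) = Coline b q"
      by (metis Coline_cases)
    hence "[b - a = 2 * pi / real n] (rmod (2 * pi))"
      using assms unfolding equiangular_hedgehog_def by (metis turns_by_Coline)
    hence "cis (b - a) = cis (2 * pi / real n)" by (simp only: cis_eq_iff)
    hence "cis b = cis a * cis (2 * pi / real n)" by (metis cis_mult add.commute diff_add_cancel)
    thus ?thesis by (simp add: ab)
  qed
  have "conormal (P j) = cis (\<alpha> + of_int j * (2 * pi / real n))" for j
  proof (induction j rule: int_induct[where k = 0])
    case base
    show ?case by (simp add: P0)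
  next
    case (step1 i)
    have "\<alpha> + of_int (i + 1) * (2 * pi / real n) =
          (\<alpha> + of_int i * (2 * pi / real n)) + 2 * pi / real n"
      by (simp add: ring_distribs add_divide_distrib)
    thus ?case using step1 by (simp only: step cis_mult)
  next
    case (step2 i)
    have "conormal (P (i - 1)) * cis (2 * pi / real n) = conormal (P i)"
      using step[of "i - 1"] by simp
    also have "\<dots> = cis (\<alpha> + of_int (i - 1) * (2 * pi / real n)) * cis (2 * pi / real n)"
    proof -
      have "(\<alpha> + of_int (i - 1) * (2 * pi / real n)) + 2 * pi / real n =
            \<alpha> + of_int i * (2 * pi / real n)"
        by (simp add: ring_distribs diff_divide_distrib)
      thus ?thesis using step2 by (simp only: cis_mult)
    qed
    finally show ?case by (metis mult_right_cancel cis_neq_zero)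
  qed
  hence "P j = Coline (\<alpha> + of_int j * (2 * pi / real n)) (offset (P j))" for j
    by (auto intro!: coline_eqI)
  thus thesis by (rule that)
qed

lemma equiangular_repI:
  assumes n: "n \<ge> 3" and per: "\<And>j. p (j + int n) = p j"
  shows "equiangular_hedgehog n (\<lambda>j. Coline (\<alpha> + of_int j * (2 * pi / real n)) (p j))"
proof -
  have "sin (2 * pi / real n) > 0"
    using n by (intro sin_gt_zero) (auto simp: field_simps)
  hence s: "sin (2 * pi / real n) \<noteq> 0" by simp
  have e: "\<alpha> + of_int (j + 1) * (2 * pi / real n) =
           \<alpha> + of_int j * (2 * pi / real n) + 2 * pi / real n" for j
    by (simp add: ring_distribs add_divide_distrib)
  have "Coline (\<alpha> + of_int (j + int n) * (2 * pi / real n)) (p (j + int n)) =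
        Coline (\<alpha> + of_int j * (2 * pi / real n)) (p j)" for j
  proof -
    have "\<alpha> + of_int (j + int n) * (2 * pi / real n) =
          \<alpha> + of_int j * (2 * pi / real n) + 2 * pi"
      using n by (simp add: field_simps)
    hence "cis (\<alpha> + of_int (j + int n) * (2 * pi / real n)) =
           cis (\<alpha> + of_int j * (2 * pi / real n))"
      by (simp flip: cis_mult)
    thus ?thesis by (simp add: Coline_eq_iff per cis_eq_iff)
  qed
  thus ?thesis
    unfolding equiangular_hedgehog_def cooriented_polygon_def e
    using crossing_Coline[OF s] by (simp add: turns_by_Coline)
qed

lemma A_evolute_rep:
  assumes n: "n \<ge> 3" and P: "\<And>j. P j = Coline (\<alpha> + of_int j * (2 * pi / real n)) (p j)"
  shows "A_evolute P j =
    Coline (\<alpha> + of_int j * (2 * pi / real n) + pi / real n + pi / 2)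
      ((p (j + 1) - p j) / (2 * sin (pi / real n)))"
proof -
  have e: "\<alpha> + of_int (j + 1) * (2 * pi / real n) =
           \<alpha> + of_int j * (2 * pi / real n) + 2 * pi / real n"
    by (simp add: ring_distribs add_divide_distrib)
  have "0 < 2 * pi / real n" "2 * pi / real n < pi"
    using n by (auto simp: field_simps)
  from interior_bisector_Coline[OF this]
  show ?thesis unfolding A_evolute_def P e by simp
qed

lemma signed_length_rep:
  assumes n: "n \<ge> 3" and P: "\<And>j. P j = Coline (\<alpha> + of_int j * (2 * pi / real n)) (p j)"
  shows "signed_length P j =
    (p (j + 1) + p (j - 1) - 2 * cos (2 * pi / real n) * p j) / sin (2 * pi / real n)"
proof -
  define \<theta> where "\<theta> = 2 * pi / real n"
  define a where "a = \<alpha> + of_int j * \<theta>"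
  define s where "s = (p (j + 1) + p (j - 1) - 2 * cos \<theta> * p j) / sin \<theta>"
  have th: "sin \<theta> > 0" unfolding \<theta>_def
    using n by (intro sin_gt_zero) (auto simp: field_simps)
  hence th': "sin \<theta> \<noteq> 0" "sin (- \<theta>) \<noteq> 0" by auto
  have Pj: "P j = Coline a (p j)" "P (j + 1) = Coline (a + \<theta>) (p (j + 1))"
    "P (j - 1) = Coline (a + (- \<theta>)) (p (j - 1))"
    by (auto simp: P \<theta>_def a_def algebra_simps add_divide_distrib diff_divide_distrib)
  have v1: "vertex P j = cis a * Complex (p j) ((p (j + 1) - p j * cos \<theta>) / sin \<theta>)"
    unfolding vertex_def Pj by (rule meet_Coline[OF th'(1)])
  have "vertex P (j - 1) = meet (P j) (P (j - 1))"
    unfolding vertex_def meet_def by (simp add: conj_commute)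
  also have "\<dots> = cis a * Complex (p j) ((p (j - 1) - p j * cos (- \<theta>)) / sin (- \<theta>))"
    unfolding Pj by (rule meet_Coline[OF th'(2)])
  finally have v2: "vertex P (j - 1) =
      cis a * Complex (p j) (- (p (j - 1) - p j * cos \<theta>) / sin \<theta>)"
    by (simp only: cos_minus sin_minus divide_minus_right minus_divide_left)
  have "vertex P j - vertex P (j - 1) = cis a * (\<i> * of_real s)"
    unfolding v1 v2 right_diff_distrib[symmetric] s_def
    by (rule arg_cong[where f = "\<lambda>x. cis a * x"])
       (simp add: complex_eq_iff add_divide_distrib diff_divide_distrib)
  hence d: "vertex P j - vertex P (j - 1) = s *\<^sub>R orient (P j)"
    by (simp only: orient_def Pj(1) conormal_Coline scaleR_conv_of_real mult_ac)
  have no: "norm (orient (P j)) = 1"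
    by (simp add: orient_def Pj(1) norm_mult)
  have "inner (vertex P j - vertex P (j - 1)) (orient (P j)) = s * (norm (orient (P j)))\<^sup>2"
    unfolding d by (simp only: inner_scaleR_left dot_square_norm)
  hence "inner (vertex P j - vertex P (j - 1)) (orient (P j)) = s"
    by (simp only: no power_one mult_1_right)
  moreover have "dist (vertex P (j - 1)) (vertex P j) = norm (s *\<^sub>R orient (P j))"
    by (simp only: dist_norm norm_minus_commute[of "vertex P (j - 1)"] d)
  hence "dist (vertex P (j - 1)) (vertex P j) = \<bar>s\<bar>"
    by (simp only: norm_scaleR no mult_1_right)
  ultimately show ?thesis
    unfolding signed_length_def s_def[symmetric] \<theta>_def[symmetric] by auto
qed

lemma sum_periodic_shift:
  fixes f :: "int \<Rightarrow> 'a::ab_group_add"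
  assumes "\<And>j. f (j + int n) = f j"
  shows "(\<Sum>j = 0..<int n. f (j + 1)) = (\<Sum>j = 0..<int n. f j)"
proof (cases "n = 0")
  case False
  have "(\<Sum>j = 0..<int n. f (j + 1)) = (\<Sum>j = 1..<int n + 1. f j)"
    by (rule sum.reindex_bij_witness[of _ "\<lambda>j. j - 1" "\<lambda>j. j + 1"]) auto
  also have "{1..<int n + 1} = insert (int n) {1..<int n}" using False by auto
  also have "(\<Sum>j\<in>\<dots>. f j) = f 0 + (\<Sum>j = 1..<int n. f j)"
    using assms[of 0] by simp
  also have "\<dots> = (\<Sum>j\<in>insert 0 {1..<int n}. f j)" by simp
  also have "insert 0 {1..<int n} = {0..<int n}" using False by auto
  finally show ?thesis .
qed simp

lemma equiangular_offset_periodic: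
  "equiangular_hedgehog n P \<Longrightarrow> offset (P (j + int n)) = offset (P j)"
  by (simp add: equiangular_hedgehog_def cooriented_polygon_def)

lemma perimeter_eq_0_iff:
  assumes n: "n \<ge> 3" and P: "equiangular_hedgehog n P"
  shows "perimeter n P = 0 \<longleftrightarrow> (\<Sum>j = 0..<int n. offset (P j)) = 0"
proof -
  define \<theta> where "\<theta> = 2 * pi / real n"
  obtain \<alpha> where rep: "\<And>j. P j = Coline (\<alpha> + of_int j * (2 * pi / real n)) (offset (P j))"
    using equiangular_rep[OF P] by blast
  note per = equiangular_offset_periodic[OF P]
  let ?S = "\<Sum>j = 0..<int n. offset (P j)"
  have th: "sin \<theta> > 0" "cos \<theta> < 1"
  proof -
    have "0 < \<theta>" "\<theta> < pi" using n by (auto simp: \<theta>_def field_simps)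
    thus "sin \<theta> > 0" "cos \<theta> < 1"
      using cos_monotone_0_pi[of 0 \<theta>] by (auto intro: sin_gt_zero)
  qed
  have s1: "(\<Sum>j = 0..<int n. offset (P (j + 1))) = ?S"
    by (rule sum_periodic_shift[of "\<lambda>j. offset (P j)"]) (rule per)
  have "offset (P (j + int n - 1)) = offset (P (j - 1))" for j
    using per[of "j - 1"] by (simp add: algebra_simps)
  hence s2: "?S = (\<Sum>j = 0..<int n. offset (P (j - 1)))"
    using sum_periodic_shift[of "\<lambda>j. offset (P (j - 1))" n] by simp
  have "perimeter n P = (\<Sum>j = 0..<int n.
      (offset (P (j + 1)) + offset (P (j - 1)) - 2 * cos \<theta> * offset (P j)) / sin \<theta>)"
    unfolding perimeter_def \<theta>_def by (intro sum.cong refl signed_length_rep[OF n rep])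
  also have "\<dots> = (?S + ?S - 2 * cos \<theta> * ?S) / sin \<theta>"
    by (simp add: sum_divide_distrib[symmetric] sum.distrib sum_subtractf
        sum_distrib_left[symmetric] s1 flip: s2)
  also have "\<dots> = 2 * (1 - cos \<theta>) / sin \<theta> * ?S" by (simp add: field_simps)
  finally show ?thesis using th by auto
qed

lemma A_evolvent_ex1:
  assumes n: "n \<ge> 3" and Q: "equiangular_hedgehog n Q" "perimeter n Q = 0"
  shows "\<exists>!P. equiangular_hedgehog n P \<and> perimeter n P = 0 \<and> A_evolute P = Q"
proof -
  define c where "c = 2 * sin (pi / real n)"
  have "c > 0" using n by (auto simp: c_def field_simps intro!: sin_gt_zero)
  define q where "q = (\<lambda>j. offset (Q j))"
  have per: "q (j + int n) = q j" for j
    using equiangular_offset_periodic[OF Q(1)] by (simp add: q_def)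
  have q0: "(\<Sum>j = 0..<int n. q j) = 0"
    using perimeter_eq_0_iff[OF n Q(1)] Q(2) by (simp add: q_def)
  obtain \<beta> where rep: "\<And>j. Q j = Coline (\<beta> + of_int j * (2 * pi / real n)) (q j)"
    using equiangular_rep[OF Q(1)] unfolding q_def by blast
  have qmod: "q j = q (j mod int n)" for j
  proof -
    have shift: "q (i + int k * int n) = q i" for i k
    proof (induction k)
      case (Suc k)
      have "q (i + int (Suc k) * int n) = q ((i + int k * int n) + int n)"
        by (simp add: algebra_simps)
      thus ?case using Suc per by simp
    qed simp
    show ?thesis
    proof (cases "j div int n \<ge> 0")
      case True
      thus ?thesis using shift[of "j mod int n" "nat (j div int n)"] by simp
    next
      case False
      thus ?thesis using shift[of j "nat (- (j div int n))"]
        by (simp add: minus_mult_left[symmetric] minus_div_mult_eq_mod)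
    qed
  qed
  define s where "s = (\<lambda>j::int. c * (\<Sum>i = 0..<j mod int n. q i))"
  have sstep: "s (j + 1) - s j = c * q j" for j
  proof -
    have m: "0 \<le> j mod int n" "j mod int n < int n" using n by auto
    have "(\<Sum>i = 0..<(j + 1) mod int n. q i) = (\<Sum>i = 0..<j mod int n + 1. q i)"
    proof (cases "j mod int n + 1 = int n")
      case True
      hence "(j + 1) mod int n = 0" by (metis mod_add_left_eq mod_self)
      thus ?thesis using True q0 by simp
    next
      case False
      hence "(j + 1) mod int n = j mod int n + 1"
        using m mod_pos_pos_trivial[of "j mod int n + 1" "int n"]
        by (simp add: mod_add_left_eq)
      thus ?thesis by simp
    qed
    also have "{0..<j mod int n + 1} = insert (j mod int n) {0..<j mod int n}" using m by auto
    also have "(\<Sum>i\<in>\<dots>. q i) = q j + (\<Sum>i = 0..<j mod int n. q i)"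
      using qmod[of j] by simp
    finally show ?thesis by (simp add: s_def algebra_simps)
  qed
  define K where "K = (\<Sum>j = 0..<int n. s j) / real n"
  define p where "p = (\<lambda>j. s j - K)"
  define \<alpha> where "\<alpha> = \<beta> - pi / real n - pi / 2"
  define P where "P = (\<lambda>j::int. Coline (\<alpha> + of_int j * (2 * pi / real n)) (p j))"
  have Peq: "equiangular_hedgehog n P" unfolding P_def
    by (rule equiangular_repI[OF n]) (simp add: p_def s_def)
  have "(\<Sum>j = 0..<int n. offset (P j)) = 0"
    using n by (simp add: P_def p_def sum_subtractf K_def)
  hence Pper: "perimeter n P = 0" using perimeter_eq_0_iff[OF n Peq] by simp
  have Pev: "A_evolute P = Q"
  proof
    fix j
    have "A_evolute P j = Coline (\<alpha> + of_int j * (2 * pi / real n) + pi / real n + pi / 2)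
      ((p (j + 1) - p j) / (2 * sin (pi / real n)))"
      by (rule A_evolute_rep[OF n]) (simp add: P_def)
    also have "(p (j + 1) - p j) / (2 * sin (pi / real n)) = q j"
      using sstep[of j] \<open>c > 0\<close> by (simp add: p_def c_def[symmetric])
    finally show "A_evolute P j = Q j" by (simp add: rep \<alpha>_def algebra_simps)
  qed
  show ?thesis
  proof (rule ex_ex1I)
    show "\<exists>P. equiangular_hedgehog n P \<and> perimeter n P = 0 \<and> A_evolute P = Q"
      using Peq Pper Pev by blast
  next
    fix X Y
    assume X: "equiangular_hedgehog n X \<and> perimeter n X = 0 \<and> A_evolute X = Q"
      and Y: "equiangular_hedgehog n Y \<and> perimeter n Y = 0 \<and> A_evolute Y = Q"
    have *: "conormal (Z j) * cis (pi / real n + pi / 2) = conormal (Q j) \<and>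
             offset (Z (j + 1)) - offset (Z j) = c * q j"
      if Z: "equiangular_hedgehog n Z" "A_evolute Z = Q" for Z j
    proof -
      obtain a where a: "\<And>j. Z j = Coline (a + of_int j * (2 * pi / real n)) (offset (Z j))"
        using equiangular_rep[OF Z(1)] by blast
      have Qj: "Q j = Coline (a + of_int j * (2 * pi / real n) + pi / real n + pi / 2)
          ((offset (Z (j + 1)) - offset (Z j)) / (2 * sin (pi / real n)))"
        using A_evolute_rep[OF n a] Z(2) by simp
      have "q j = (offset (Z (j + 1)) - offset (Z j)) / c"
        unfolding q_def Qj c_def by simp
      moreover have "conormal (Q j) = conormal (Z j) * cis (pi / real n + pi / 2)"
        unfolding Qj by (subst a) (simp add: cis_mult add_ac)
      ultimately show ?thesis using \<open>c > 0\<close> by simp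
    qed
    define d where "d = (\<lambda>j. offset (X j) - offset (Y j))"
    have dstep: "d (j + 1) = d j" for j
      using *[of X j] *[of Y j] X Y by (simp add: d_def)
    have dc: "d j = d 0" for j
    proof (induction j rule: int_induct[where k = 0])
      case (step2 i)
      thus ?case using dstep[of "i - 1"] by simp
    qed (use dstep in auto)
    have "(\<Sum>j = 0..<int n. d j) = 0"
      using perimeter_eq_0_iff[OF n, of X] perimeter_eq_0_iff[OF n, of Y] X Y
      by (simp add: d_def sum_subtractf)
    moreover have "(\<Sum>j = 0..<int n. d j) = (\<Sum>j = 0..<int n. d 0)"
      by (intro sum.cong refl dc)
    ultimately have "d 0 = 0" using n by simp
    have "conormal (X j) = conormal (Y j)" for j
      using *[of X j] *[of Y j] X Y by (metis mult_right_cancel cis_neq_zero)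
    moreover have "offset (X j) = offset (Y j)" for j
      using dc[of j] \<open>d 0 = 0\<close> by (simp add: d_def)
    ultimately show "X = Y" by (intro ext coline_eqI)
  qed
qed

end

theory Submission
  imports Defs
begin

text \<open>
  Let \<open>w\<^sub>j\<close> be the normals and \<open>p\<^sub>j\<close> the offsets of an equiangular hedgehog. Its vertex centroid is
  \<open>C = (2/n) \<Sum> p\<^sub>j w\<^sub>j\<close>, which summation by parts shows to be unchanged by the evolute. Measured
  from \<open>C\<close>, the offsets \<open>u\<^sub>j\<close> have vanishing Fourier modes \<open>0\<close> (zero perimeter) and \<open>\<plusminus>1\<close> (choice
  of \<open>C\<close>). The evolvent multiplies the \<open>m\<close>-th mode by a factor of modulus
  \<open>sin (\<pi>/n) / sin (m \<pi>/n)\<close>, which is less than \<open>1\<close> for the remaining \<open>m\<close>, so all \<open>u\<^sub>j\<close> tend to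
  \<open>0\<close>; the vertices depend linearly on them.
\<close>

section \<open>Discrete Fourier transform\<close>

definition dft :: "nat \<Rightarrow> (int \<Rightarrow> complex) \<Rightarrow> int \<Rightarrow> complex" where
  "dft n f m = (\<Sum>j = 0..<int n. f j * cis (- (2 * pi * of_int (j * m) / real n)))"

lemma cis_plus_multiple_2pi: "cis (x + 2 * pi * of_int k) = cis x"
  by (simp add: cis_multiple_2pi flip: cis_mult)

lemma cis_2pi_div_eq_1_iff:
  assumes "n > 0"
  shows "cis (2 * pi * of_int k / real n) = 1 \<longleftrightarrow> int n dvd k"
proof
  assume "cis (2 * pi * of_int k / real n) = 1"
  then obtain i :: int where "2 * pi * of_int k / real n = of_int i * (2 * pi)"
    by (auto simp: cis_conv_exp exp_eq_1)
  hence "real_of_int k = of_int (i * int n)"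
    using assms by (simp add: field_simps)
  hence "k = i * int n" by (simp only: of_int_eq_iff)
  thus "int n dvd k" by simp
next
  assume "int n dvd k"
  then obtain i where "k = int n * i" by auto
  hence "2 * pi * of_int k / real n = 2 * pi * of_int i"
    using assms by simp
  thus "cis (2 * pi * of_int k / real n) = 1"
    by (simp add: cis_multiple_2pi)
qed

text \<open>Orthogonality of the characters of the integers modulo \<open>n\<close>: a geometric sum
  whose ratio is an \<open>n\<close>-th root of unity, equal to 1 exactly when \<open>n\<close>
  divides \<open>k\<close>.\<close>

lemma sum_cis_2pi_div:
  assumes "n > 0"
  shows "(\<Sum>m = 0..<int n. cis (2 * pi * of_int (k * m) / real n)) =
           (if int n dvd k then of_nat n else 0)"
proof -
  define z where "z = cis (2 * pi * of_int k / real n)"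
  have "(\<Sum>m = 0..<int n. cis (2 * pi * of_int (k * m) / real n)) = (\<Sum>m<n. z ^ m)"
    by (rule sum.reindex_bij_witness[of _ int nat])
       (auto simp: z_def Complex.DeMoivre mult_ac)
  also have "\<dots> = (if int n dvd k then of_nat n else 0)"
  proof (cases "int n dvd k")
    case True
    hence "z = 1" using cis_2pi_div_eq_1_iff[OF assms] by (simp add: z_def)
    thus ?thesis using True by simp
  next
    case False
    hence "z \<noteq> 1" using cis_2pi_div_eq_1_iff[OF assms] by (simp add: z_def)
    moreover have "z ^ n = 1"
      using assms by (simp add: z_def Complex.DeMoivre cis_multiple_2pi)
    ultimately show ?thesis using False by (simp add: geometric_sum)
  qed
  finally show ?thesis .
qed

text \<open>The transform sees only the values of \<open>f\<close> on \<open>0..<int n\<close>, so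
  \<open>j\<close> is taken from that range. After the two sums are interchanged, orthogonality
  keeps only the term \<open>i = j\<close>; the transform is unnormalised, hence the factor
  \<open>n\<close>.\<close>

lemma dft_inversion:
  assumes "0 \<le> j" "j < int n"
  shows "(\<Sum>m = 0..<int n. dft n f m * cis (2 * pi * of_int (j * m) / real n)) = of_nat n * f j"
proof -
  have "(\<Sum>m = 0..<int n. dft n f m * cis (2 * pi * of_int (j * m) / real n)) =
        (\<Sum>m = 0..<int n. \<Sum>i = 0..<int n. f i * cis (2 * pi * of_int ((j - i) * m) / real n))"
    unfolding dft_def sum_distrib_right
    by (intro sum.cong refl)
       (simp add: mult.assoc cis_mult algebra_simps diff_divide_distrib)
  also have "\<dots> = (\<Sum>i = 0..<int n. f i * (if int n dvd j - i then of_nat n else 0))"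
    using assms by (subst sum.swap) (simp add: sum_cis_2pi_div flip: sum_distrib_left del: of_int_mult)
  also have "\<dots> = (\<Sum>i = 0..<int n. if i = j then of_nat n * f j else 0)"
  proof (intro sum.cong refl)
    fix i assume "i \<in> {0..<int n}"
    hence "\<bar>j - i\<bar> < int n" using assms by auto
    hence "int n dvd j - i \<longleftrightarrow> i = j"
      using dvd_imp_le_int[of "j - i" "int n"] by auto
    thus "f i * (if int n dvd j - i then of_nat n else 0) = (if i = j then of_nat n * f j else 0)"
      by simp
  qed
  also have "\<dots> = of_nat n * f j" using assms by simp
  finally show ?thesis .
qed

text \<open>The whole summand \<open>g\<close> is periodic, so its index may be shifted; the
  exponential at \<open>j + 1\<close> then splits off the constant phase.\<close>

lemma dft_shift:
  assumes "n > 0" "\<And>j. f (j + int n) = f j"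
  shows "dft n (\<lambda>j. f (j + 1)) m = cis (2 * pi * of_int m / real n) * dft n f m"
proof -
  define g where "g = (\<lambda>j. f j * cis (- (2 * pi * of_int (j * m) / real n)))"
  have "g (j + int n) = g j" for j
  proof -
    have e: "- (2 * pi * of_int ((j + int n) * m) / real n) =
          - (2 * pi * of_int (j * m) / real n) + 2 * pi * of_int (- m)"
      using assms(1) by (simp add: field_simps)
    show ?thesis unfolding g_def assms(2) e cis_plus_multiple_2pi ..
  qed
  hence "(\<Sum>j = 0..<int n. g (j + 1)) = (\<Sum>j = 0..<int n. g j)"
    by (rule sum_periodic_shift)
  hence "dft n f m = (\<Sum>j = 0..<int n. g (j + 1))"
    by (simp add: dft_def g_def)
  hence "cis (2 * pi * of_int m / real n) * dft n f m =
        (\<Sum>j = 0..<int n. cis (2 * pi * of_int m / real n) * g (j + 1))"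
    by (simp only: sum_distrib_left)
  also have "\<dots> = dft n (\<lambda>j. f (j + 1)) m"
    unfolding dft_def g_def
    by (intro sum.cong refl)
       (simp add: mult.left_commute cis_mult algebra_simps add_divide_distrib)
  finally show ?thesis by simp
qed

lemma periodic_mod:
  fixes f :: "int \<Rightarrow> 'a"
  assumes "\<And>j. f (j + n) = f j"
  shows "f (j mod n) = f j"
proof -
  have "f (i + k * n) = f i" for i k
  proof (induction k rule: int_induct[where k = 0])
    case (step1 k)
    thus ?case using assms[of "i + k * n"] by (simp add: algebra_simps)
  next
    case (step2 k)
    thus ?case using assms[of "i + (k - 1) * n"] by (simp add: algebra_simps)
  qed simp
  from this[of "j mod n" "j div n"] show ?thesis by simp
qed

section \<open>Decay of the Fourier modes under repeated antidifferences\<close>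

text \<open>The difference of the sines is \<open>2 * sin a * cos b\<close> with \<open>a\<close>
  and \<open>b\<close> half the difference and half the sum of the angles. The bounds on
  \<open>m\<close> put \<open>a\<close> between 0 and \<open>pi\<close> and \<open>b\<close> between
  0 and \<open>pi / 2\<close>. This is the strict contraction of the modes from 2 to
  \<open>n - 2\<close>.\<close>

lemma sin_pi_div_less:
  assumes "2 \<le> m" "m + 2 \<le> int n"
  shows "sin (pi / real n) < sin (pi * of_int m / real n)"
proof -
  have n: "real n > 0" and m: "real_of_int m \<ge> 2" "real_of_int m + 2 \<le> real n"
    using assms by linarith+
  define a b where "a = (pi * of_int m / real n - pi / real n) / 2"
    and "b = (pi * of_int m / real n + pi / real n) / 2"
  have ab: "a = pi * ((of_int m - 1) / (2 * real n))" "b = pi * ((of_int m + 1) / (2 * real n))"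
    using n by (simp_all add: a_def b_def field_simps)
  have "0 < (of_int m - 1) / (2 * real n)" "(of_int m - 1) / (2 * real n) < 1"
    "0 < (of_int m + 1) / (2 * real n)" "(of_int m + 1) / (2 * real n) < 1 / 2"
    using n m by (simp_all add: field_simps)
  from this(1,3) this(2,4)[THEN mult_strict_left_mono, OF pi_gt_zero]
  have "0 < a" "a < pi" "0 < b" "b < pi / 2"
    unfolding ab by (simp_all only: mult_pos_pos[OF pi_gt_zero] mult_1_right times_divide_eq_right[of pi 1 2])
  hence "0 < 2 * sin a * cos b" by (simp add: sin_gt_zero cos_gt_zero)
  also have "\<dots> = sin (pi * of_int m / real n) - sin (pi / real n)"
    unfolding a_def b_def by (rule sin_diff_sin[symmetric])
  finally show ?thesis by simp
qed

text \<open>Taking differences acts diagonally on Fourier modes, so each mode can be followed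
  separately. The modes 0, 1 and \<open>n - 1\<close> vanish by \<open>mode0\<close> and
  \<open>mode1\<close>; every other one decays geometrically.\<close>

lemma iterated_antidifference_tendsto_0:
  fixes u :: "nat \<Rightarrow> int \<Rightarrow> real"
  assumes per: "\<And>k j. u k (j + int n) = u k j"
    and step: "\<And>k j. u (Suc k) (j + 1) - u (Suc k) j = 2 * sin (pi / real n) * u k j"
    and mode0: "\<And>k. (\<Sum>j = 0..<int n. u k j) = 0"
    and mode1: "\<And>k. (\<Sum>j = 0..<int n. of_real (u k j) * cis (2 * pi * of_int j / real n)) = 0"
    and n: "n > 0"
  shows "(\<lambda>k. u k j) \<longlonglongrightarrow> 0"
proof -
  define F where "F = (\<lambda>k. dft n (\<lambda>j. of_real (u k j)))"
  have F: "(\<lambda>k. F k m) \<longlonglongrightarrow> 0" if m: "0 \<le> m" "m < int n" for m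
  proof -
    consider "m = 0" | "m = 1" | "m = int n - 1" | "2 \<le> m" "m + 2 \<le> int n"
      using m by linarith
    thus ?thesis
    proof cases
      case 1
      have "F k m = of_real (\<Sum>j = 0..<int n. u k j)" for k
        by (simp add: F_def dft_def 1)
      thus ?thesis by (simp only: mode0) simp
    next
      case 2
      \<comment> \<open>Since \<open>u\<close> is real, its mode 1 is the conjugate of its mode -1,
        which is the sum in \<open>mode1\<close>.\<close>
      have "F k m = cnj (\<Sum>j = 0..<int n. of_real (u k j) * cis (2 * pi * of_int j / real n))" for k
        by (simp add: F_def dft_def 2 cis_cnj)
      thus ?thesis by (simp only: mode1) simp
    next
      case 3
      \<comment> \<open>The frequency \<open>n - 1\<close> agrees with -1 modulo \<open>n\<close>,
        so this mode is literally the sum in \<open>mode1\<close>.\<close>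
      have "cis (- (2 * pi * of_int (j * m) / real n)) = cis (2 * pi * of_int j / real n)" for j
      proof -
        have e: "- (2 * pi * of_int (j * m) / real n) =
              2 * pi * of_int j / real n + 2 * pi * of_int (- j)"
          using n by (simp add: 3 field_simps)
        show ?thesis unfolding e cis_plus_multiple_2pi ..
      qed
      hence "F k m = (\<Sum>j = 0..<int n. of_real (u k j) * cis (2 * pi * of_int j / real n))" for k
        by (simp add: F_def dft_def)
      thus ?thesis by (simp only: mode1) simp
    next
      case 4
      define s t where "s = sin (pi / real n)" and "t = sin (pi * of_int m / real n)"
      have st: "0 < s" "s < t"
        using sin_pi_div_less[OF 4] 4 by (auto simp: s_def t_def field_simps intro!: sin_gt_zero)
      \<comment> \<open>The transform of \<open>step\<close> reads (\<open>cis x\<close> - 1) *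
        \<open>F (Suc k) m\<close> = \<open>2 * s * F k m\<close> with
        \<open>x = 2 * pi * m / n\<close>, and the chord \<open>cis x\<close> - 1 has length
        \<open>2 * sin (x / 2)\<close>, that is \<open>2 * t\<close>.\<close>
      have norm_step: "norm (F (Suc k) m) = s / t * norm (F k m)" for k
      proof -
        have "(cis (2 * pi * of_int m / real n) - 1) * F (Suc k) m =
              dft n (\<lambda>j. of_real (u (Suc k) (j + 1))) m - F (Suc k) m"
          unfolding F_def using dft_shift[OF n, of "\<lambda>j. of_real (u (Suc k) j)" m] per
          by (simp add: algebra_simps)
        also have "\<dots> = dft n (\<lambda>j. of_real (u (Suc k) (j + 1) - u (Suc k) j)) m"
          by (simp add: F_def dft_def algebra_simps flip: sum_subtractf)
        also have "\<dots> = of_real (2 * s) * F k m"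
          unfolding step by (simp add: F_def dft_def sum_distrib_left s_def mult_ac)
        finally have "norm (cis (2 * pi * of_int m / real n) - 1) * norm (F (Suc k) m) =
              2 * s * norm (F k m)"
          using st by (metis norm_mult norm_of_real abs_of_pos mult_pos_pos zero_less_numeral)
        moreover have "norm (cis (2 * pi * of_int m / real n) - 1) = 2 * t"
          using dist_exp_i_1[of "2 * pi * of_int m / real n"] st by (simp add: cis_conv_exp t_def)
        ultimately show ?thesis using st by (simp add: field_simps)
      qed
      have "(\<lambda>k. norm (F k m)) = (\<lambda>k. (s / t) ^ k * norm (F 0 m))"
      proof
        show "norm (F k m) = (s / t) ^ k * norm (F 0 m)" for k
          by (induction k) (simp_all add: norm_step)
      qed
      moreover have "(\<lambda>k. (s / t) ^ k * norm (F 0 m)) \<longlonglongrightarrow> 0"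
        using st by (intro tendsto_mult_left_zero LIMSEQ_realpow_zero) auto
      ultimately have "(\<lambda>k. norm (F k m)) \<longlonglongrightarrow> 0" by (simp only:)
      thus ?thesis by (rule tendsto_norm_zero_cancel)
    qed
  qed
  \<comment> \<open>Inversion covers only \<open>0..<int n\<close>; periodicity carries the result
    back to \<open>j\<close>. There are finitely many modes, so their limits may be summed.\<close>
  define i where "i = j mod int n"
  have i: "0 \<le> i" "i < int n" using n by (simp_all add: i_def)
  have "(\<lambda>k. (\<Sum>m = 0..<int n. F k m * cis (2 * pi * of_int (i * m) / real n)) / of_nat n) \<longlonglongrightarrow>
        (\<Sum>m = 0..<int n. 0 * cis (2 * pi * of_int (i * m) / real n)) / of_nat n"
    using n by (intro tendsto_intros F) auto
  hence "(\<lambda>k. complex_of_real (u k i)) \<longlonglongrightarrow> 0"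
    using n unfolding F_def dft_inversion[OF i] by simp
  hence "(\<lambda>k. u k i) \<longlonglongrightarrow> 0" by (metis tendsto_of_real_iff of_real_0)
  thus ?thesis unfolding i_def using periodic_mod[of "u _" "int n" j] per by simp
qed

section \<open>Equiangular hedgehogs seen from a point\<close>

text \<open>The offset of the line after the origin has been moved to \<open>c\<close>.\<close>

definition offset_from :: "complex \<Rightarrow> coline \<Rightarrow> real" where
  "offset_from c l = offset l - inner c (conormal l)"

lemma norm_conormal [simp]: "norm (conormal l) = 1"
  by (cases l rule: Coline_cases) simp

lemma conormal_neq_0: "conormal l \<noteq> 0"
  by (cases l rule: Coline_cases) simp

lemma equiangular_conormal:
  assumes "equiangular_hedgehog n P"
  shows "conormal (P j) = conormal (P 0) * cis (2 * pi * of_int j / real n)"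
proof -
  obtain \<alpha> where "\<And>j. P j = Coline (\<alpha> + of_int j * (2 * pi / real n)) (offset (P j))"
    using equiangular_rep[OF assms] by blast
  hence "conormal (P j) = cis (\<alpha> + of_int j * (2 * pi / real n))" for j
    by (metis conormal_Coline)
  thus ?thesis by (simp add: cis_mult mult_ac)
qed

lemma equiangular_conormal_Suc:
  assumes "equiangular_hedgehog n P"
  shows "conormal (P (j + 1)) = conormal (P j) * cis (2 * pi / real n)"
  unfolding equiangular_conormal[OF assms, of j] equiangular_conormal[OF assms, of "j + 1"]
  by (simp add: cis_mult algebra_simps add_divide_distrib)

lemma equiangular_periodic:
  "equiangular_hedgehog n P \<Longrightarrow> P (j + int n) = P j"
  by (simp add: equiangular_hedgehog_def cooriented_polygon_def)

lemma sum_conormal: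
  assumes "n \<ge> 2" "equiangular_hedgehog n P"
  shows "(\<Sum>j = 0..<int n. conormal (P j)) = 0"
proof -
  have "(\<Sum>j = 0..<int n. conormal (P j)) =
      (\<Sum>j = 0..<int n. conormal (P 0) * cis (2 * pi * of_int j / real n))"
    by (intro sum.cong refl equiangular_conormal[OF assms(2)])
  thus ?thesis
    using assms(1) sum_cis_2pi_div[of n 1] by (simp flip: sum_distrib_left)
qed

text \<open>Squaring the normals gives, up to a constant factor, the character sum of frequency 2,
  which vanishes because \<open>n\<close> does not divide 2.\<close>

lemma sum_conormal_squared:
  assumes "n \<ge> 3" "equiangular_hedgehog n P"
  shows "(\<Sum>j = 0..<int n. (conormal (P j))\<^sup>2) = 0"
proof -
  have "\<not> int n dvd 2" using assms(1) zdvd_not_zless[of 2 "int n"] by simp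
  hence "(\<Sum>j = 0..<int n. cis (2 * pi * of_int (2 * j) / real n)) = 0"
    using assms(1) sum_cis_2pi_div[of n 2] by (simp del: of_int_mult)
  moreover have "(\<Sum>j = 0..<int n. (conormal (P j))\<^sup>2) =
      (\<Sum>j = 0..<int n. (conormal (P 0))\<^sup>2 * cis (2 * pi * of_int (2 * j) / real n))"
  proof (rule sum.cong[OF refl])
    show "(conormal (P j))\<^sup>2 = (conormal (P 0))\<^sup>2 * cis (2 * pi * of_int (2 * j) / real n)" for j
      unfolding equiangular_conormal[OF assms(2), of j]
      by (simp add: power_mult_distrib Complex.DeMoivre mult_ac)
  qed
  ultimately show ?thesis by (simp only: mult_zero_right flip: sum_distrib_left)
qed

lemma sin_2pi_div_pos: "n \<ge> 3 \<Longrightarrow> 0 < sin (2 * pi / real n)"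
  by (intro sin_gt_zero) (auto simp: field_simps)

lemma vertex_eq:
  assumes "n \<ge> 3" "equiangular_hedgehog n P"
  shows "vertex P j = conormal (P j) * Complex (offset (P j))
    ((offset (P (j + 1)) - offset (P j) * cos (2 * pi / real n)) / sin (2 * pi / real n))"
proof -
  obtain \<alpha> where a: "P j = Coline \<alpha> (offset (P j))" by (metis Coline_cases offset_Coline)
  have "P (j + 1) = Coline (\<alpha> + 2 * pi / real n) (offset (P (j + 1)))"
    using equiangular_conormal_Suc[OF assms(2), of j] a
    by (intro coline_eqI) (metis cis_mult conormal_Coline, simp)
  thus ?thesis
    unfolding vertex_def using meet_Coline[of "2 * pi / real n" \<alpha>] a sin_2pi_div_pos[OF assms(1)]
    by (metis conormal_Coline less_irrefl)
qed

text \<open>The formula of \<open>vertex_eq\<close> is invariant under translation of the origin. It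
  is linear in two neighbouring offsets, so vertices approach \<open>c\<close> once all offsets from
  \<open>c\<close> tend to 0.\<close>

lemma vertex_diff:
  assumes "n \<ge> 3" "equiangular_hedgehog n P"
  shows "vertex P j - c = conormal (P j) * Complex (offset_from c (P j))
    ((offset_from c (P (j + 1)) - offset_from c (P j) * cos (2 * pi / real n)) / sin (2 * pi / real n))"
proof -
  define w \<theta> where "w = conormal (P j)" and "\<theta> = 2 * pi / real n"
  have w: "w * cnj w = 1" by (simp add: w_def complex_norm_square[symmetric])
  \<comment> \<open>Coordinates of \<open>c\<close> in the orthonormal frame formed by
    \<open>w\<close> and its counterclockwise quarter turn.\<close>
  define a b where "a = Re (c * cnj w)" and "b = Im (c * cnj w)"
  have "Complex a b = c * cnj w" by (simp only: a_def b_def complex_surj)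
  hence c: "c = w * Complex a b" using w by (simp only: mult.left_commute mult_1_right)
  have ia: "inner c w = a" by (simp add: a_def inner_complex_def)
  have ib: "inner c (w * cis \<theta>) = a * cos \<theta> + b * sin \<theta>"
    by (simp add: a_def b_def inner_complex_def algebra_simps)
  have s: "sin \<theta> \<noteq> 0" using sin_2pi_div_pos[OF assms(1)] by (simp add: \<theta>_def)
  have "vertex P j - c = w * (Complex (offset (P j))
      ((offset (P (j + 1)) - offset (P j) * cos \<theta>) / sin \<theta>) - Complex a b)"
    using vertex_eq[OF assms, of j] c by (simp add: right_diff_distrib flip: w_def \<theta>_def)
  also have "Complex (offset (P j)) ((offset (P (j + 1)) - offset (P j) * cos \<theta>) / sin \<theta>) - Complex a b =
    Complex (offset_from c (P j))
      ((offset_from c (P (j + 1)) - offset_from c (P j) * cos \<theta>) / sin \<theta>)"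
  proof -
    have "inner c (conormal (P (j + 1))) = a * cos \<theta> + b * sin \<theta>"
      unfolding equiangular_conormal_Suc[OF assms(2)] w_def[symmetric] \<theta>_def[symmetric] by (rule ib)
    thus ?thesis
      using s ia by (simp add: offset_from_def complex_eq_iff field_simps flip: w_def)
  qed
  finally show ?thesis by (simp only: w_def \<theta>_def)
qed

section \<open>The vertex centroid in terms of normals and offsets\<close>

text \<open>Each vertex is a combination, with coefficients independent of \<open>j\<close>, of
  offset times normal for its two sides. Summed over a period both sides contribute the same
  \<open>S\<close>, and the two coefficients add up to 2.\<close>

lemma vertex_centroid_eq:
  assumes "n \<ge> 3" "equiangular_hedgehog n P"
  shows "vertex_centroid n P = 2 / of_nat n * (\<Sum>j = 0..<int n. offset (P j) * conormal (P j))"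
proof -
  define \<theta> where "\<theta> = 2 * pi / real n"
  define S where "S = (\<Sum>j = 0..<int n. offset (P j) * conormal (P j))"
  have s: "complex_of_real (sin \<theta>) \<noteq> 0"
    using sin_2pi_div_pos[OF assms(1)] by (simp add: \<theta>_def)
  have v: "vertex P j = offset (P j) * conormal (P j) * (1 - \<i> * cos \<theta> / sin \<theta>) +
      \<i> * cis (- \<theta>) / sin \<theta> * (offset (P (j + 1)) * conormal (P (j + 1)))" for j
  proof -
    \<comment> \<open>The part of the vertex containing the next offset is to be expressed with the
      next normal, so that the cyclic shift applies to it.\<close>
    have "cis (- \<theta>) * conormal (P (j + 1)) = conormal (P j) * (cis \<theta> * cis (- \<theta>))"
      unfolding equiangular_conormal_Suc[OF assms(2)] \<theta>_def by simp
    hence w: "conormal (P j) = cis (- \<theta>) * conormal (P (j + 1))"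
      unfolding cis_mult by simp
    show ?thesis
      using s unfolding vertex_eq[OF assms] \<theta>_def[symmetric] Complex_eq w
      by (simp add: field_simps)
  qed
  have "(\<Sum>j = 0..<int n. vertex P j) =
      S * (1 - \<i> * cos \<theta> / sin \<theta>) + \<i> * cis (- \<theta>) / sin \<theta> *
      (\<Sum>j = 0..<int n. offset (P (j + 1)) * conormal (P (j + 1)))"
    unfolding v sum.distrib S_def sum_distrib_left sum_distrib_right ..
  also have "(\<Sum>j = 0..<int n. offset (P (j + 1)) * conormal (P (j + 1))) = S"
    unfolding S_def
    by (rule sum_periodic_shift[of "\<lambda>j. offset (P j) * conormal (P j)"])
       (simp add: equiangular_periodic[OF assms(2)])
  also have "S * (1 - \<i> * cos \<theta> / sin \<theta>) + \<i> * cis (- \<theta>) / sin \<theta> * S =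
      S * (1 + \<i> * (cis (- \<theta>) - cos \<theta>) / sin \<theta>)"
    by (simp add: algebra_simps diff_divide_distrib)
  also have "cis (- \<theta>) - cos \<theta> = - \<i> * sin \<theta>"
    by (simp add: complex_eq_iff)
  finally show ?thesis using s by (simp add: vertex_centroid_def S_def)
qed

section \<open>The evolute as a difference operator\<close>

lemma A_evolute_coords:
  assumes "n \<ge> 3" "equiangular_hedgehog n P"
  shows "conormal (A_evolute P j) = conormal (P j) * cis (pi / real n + pi / 2)"
    and "offset (A_evolute P j) = (offset (P (j + 1)) - offset (P j)) / (2 * sin (pi / real n))"
proof -
  obtain \<alpha> where a: "\<And>j. P j = Coline (\<alpha> + of_int j * (2 * pi / real n)) (offset (P j))"
    using equiangular_rep[OF assms(2)] by blast
  have "conormal (P j) = cis (\<alpha> + of_int j * (2 * pi / real n))" by (metis a conormal_Coline)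
  thus "conormal (A_evolute P j) = conormal (P j) * cis (pi / real n + pi / 2)"
    unfolding A_evolute_rep[OF assms(1) a] by (simp add: cis_mult add_ac)
  show "offset (A_evolute P j) = (offset (P (j + 1)) - offset (P j)) / (2 * sin (pi / real n))"
    unfolding A_evolute_rep[OF assms(1) a] by simp
qed

lemma cis_double_minus_1: "cis (2 * x) - 1 = of_real (2 * sin x) * cis (x + pi / 2)"
  by (simp add: complex_eq_iff sin_add cos_add cos_double_sin sin_double power2_eq_square)

text \<open>The difference of consecutive normals is a chord of the unit circle; its direction is
  the normal of the bisector and its length is \<open>2 * sin (pi / real n)\<close>.\<close>

lemma conormal_A_evolute_diff:
  assumes "n \<ge> 3" "equiangular_hedgehog n P"
  shows "conormal (P (j + 1)) - conormal (P j) =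
    of_real (2 * sin (pi / real n)) * conormal (A_evolute P j)"
  unfolding equiangular_conormal_Suc[OF assms(2)] A_evolute_coords[OF assms]
  using cis_double_minus_1[of "pi / real n"] by (simp add: algebra_simps)

lemma sin_pi_div_pos: "n \<ge> 2 \<Longrightarrow> 0 < sin (pi / real n)"
  by (intro sin_gt_zero) (auto simp: field_simps)

text \<open>Offsets and inner products of \<open>c\<close> with the normals obey the same difference
  relation, hence so do the offsets from any point \<open>c\<close>. Read from the evolute back to
  \<open>P\<close>, it is the recurrence of
  \<open>iterated_antidifference_tendsto_0\<close>.\<close>

lemma offset_from_A_evolute:
  assumes "n \<ge> 3" "equiangular_hedgehog n P"
  shows "offset_from c (P (j + 1)) - offset_from c (P j) =
    2 * sin (pi / real n) * offset_from c (A_evolute P j)"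
proof -
  have "inner c (conormal (P (j + 1))) - inner c (conormal (P j)) =
      2 * sin (pi / real n) * inner c (conormal (A_evolute P j))"
    unfolding inner_diff_right[symmetric] conormal_A_evolute_diff[OF assms]
    by (simp add: inner_complex_def algebra_simps)
  thus ?thesis
    using A_evolute_coords(2)[OF assms, of j] sin_pi_div_pos[of n] assms(1)
    by (simp add: offset_from_def field_simps)
qed

text \<open>Summation by parts: writing \<open>w j * z\<close> as \<open>w (j + 1) * y\<close> turns
  the sum of differences into \<open>(y - z) * S\<close>, and \<open>y - z\<close> equals the
  denominator \<open>s\<close> of the evolute's offsets.\<close>

lemma vertex_centroid_A_evolute:
  assumes "n \<ge> 3" "equiangular_hedgehog n P" "equiangular_hedgehog n (A_evolute P)"
  shows "vertex_centroid n (A_evolute P) = vertex_centroid n P"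
proof -
  define s w p where "s = 2 * sin (pi / real n)" and "w = (\<lambda>j. conormal (P j))"
    and "p = (\<lambda>j. complex_of_real (offset (P j)))"
  define z where "z = cis (pi / real n + pi / 2)"
  define S where "S = (\<Sum>j = 0..<int n. p j * w j)"
  have s: "complex_of_real s \<noteq> 0" using sin_pi_div_pos[of n] assms(1) by (simp add: s_def)
  define y where "y = z * cis (- (2 * pi / real n))"
  have zy: "y - z = s"
  proof -
    have "z = \<i> * cis (pi / real n)" "y = \<i> * cis (- (pi / real n))"
      by (simp_all add: z_def y_def cis_mult complex_eq_iff sin_add cos_add sin_diff cos_diff
          flip: sin_double cos_double_cos)
    thus ?thesis by (simp add: s_def complex_eq_iff)
  qed
  have w: "w j * z = w (j + 1) * y" for j
    unfolding w_def y_def equiangular_conormal_Suc[OF assms(2)]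
    using cis_mult[of "2 * pi / real n" "- (2 * pi / real n)"] by (simp add: mult_ac)
  have "s * (\<Sum>j = 0..<int n. offset (A_evolute P j) * conormal (A_evolute P j)) =
      (\<Sum>j = 0..<int n. (p (j + 1) - p j) * (w j * z))"
    unfolding sum_distrib_left A_evolute_coords[OF assms(1,2)] s_def[symmetric] w_def[symmetric] z_def[symmetric]
    using s by (intro sum.cong refl) (simp add: p_def w_def)
  also have "\<dots> = y * (\<Sum>j = 0..<int n. p (j + 1) * w (j + 1)) - z * S"
    unfolding S_def sum_distrib_left sum_subtractf[symmetric]
  proof (intro sum.cong refl)
    show "(p (j + 1) - p j) * (w j * z) = y * (p (j + 1) * w (j + 1)) - z * (p j * w j)" for j
      using w[of j] by algebra
  qed
  also have "(\<Sum>j = 0..<int n. p (j + 1) * w (j + 1)) = S"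
    unfolding S_def
    by (rule sum_periodic_shift[of "\<lambda>j. p j * w j"])
       (simp add: equiangular_periodic[OF assms(2)] p_def w_def)
  finally have "(\<Sum>j = 0..<int n. offset (A_evolute P j) * conormal (A_evolute P j)) = S"
    using s zy by (simp add: algebra_simps)
  thus ?thesis
    unfolding vertex_centroid_eq[OF assms(1,2)] vertex_centroid_eq[OF assms(1,3)] S_def p_def w_def
    by simp
qed

section \<open>Vanishing of the lowest modes\<close>

text \<open>Zero perimeter means that the offsets sum to 0, and moving the origin preserves this
  because the normals also sum to 0.\<close>

lemma sum_offset_from:
  assumes "n \<ge> 3" "equiangular_hedgehog n P" "perimeter n P = 0"
  shows "(\<Sum>j = 0..<int n. offset_from c (P j)) = 0"
  using perimeter_eq_0_iff[OF assms(1,2)] assms(1,3) sum_conormal[OF _ assms(2)]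
  by (simp add: offset_from_def sum_subtractf flip: inner_sum_right)

text \<open>Moving the origin to \<open>c\<close> subtracts \<open>n * c / 2\<close> from the sum of
  offset times normal, since the squared normals cancel. By \<open>vertex_centroid_eq\<close> the
  centroid is the choice of \<open>c\<close> that makes the result 0.\<close>

lemma sum_offset_from_centroid_conormal:
  assumes "n \<ge> 3" "equiangular_hedgehog n P"
  shows "(\<Sum>j = 0..<int n. offset_from (vertex_centroid n P) (P j) * conormal (P j)) = 0"
proof -
  define c where "c = vertex_centroid n P"
  have "inner c w * w = c / 2 + cnj c / 2 * w\<^sup>2" if "norm w = 1" for w :: complex
  proof -
    have w: "w * cnj w = 1" using that by (simp add: complex_norm_square[symmetric])
    have "complex_of_real (inner c w) = (c * cnj w + cnj c * w) / 2"
      by (simp add: complex_eq_iff inner_complex_def)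
    hence "inner c w * w = (c * (w * cnj w) + cnj c * w\<^sup>2) / 2"
      by (simp add: algebra_simps power2_eq_square)
    thus ?thesis by (simp add: w add_divide_distrib)
  qed
  hence "(\<Sum>j = 0..<int n. inner c (conormal (P j)) * conormal (P j)) = of_nat n * c / 2"
    using sum_conormal_squared[OF assms]
    by (simp add: sum.distrib flip: sum_distrib_left sum_divide_distrib)
  also have "\<dots> = (\<Sum>j = 0..<int n. offset (P j) * conormal (P j))"
    unfolding c_def vertex_centroid_eq[OF assms] using assms(1) by simp
  finally show ?thesis
    by (simp add: offset_from_def left_diff_distrib sum_subtractf flip: c_def)
qed

section \<open>Convergence of the vertices of the iterated evolvents\<close>

theorem theorem10:
  fixes n :: nat and Q :: "nat \<Rightarrow> int \<Rightarrow> coline"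
  assumes "n \<ge> 3"
    and "equiangular_hedgehog n (Q 0)"
    and "perimeter n (Q 0) = 0"
    and "\<And>k. Q (Suc k) = A_evolvent n (Q k)"
  shows "\<forall>j. (\<lambda>k. vertex (Q k) j) \<longlonglongrightarrow> vertex_centroid n (Q 0)"
proof
  fix j
  define C where "C = vertex_centroid n (Q 0)"
  define \<theta> where "\<theta> = 2 * pi / real n"
  \<comment> \<open>Existence and uniqueness make the definite description in
    \<open>A_evolvent\<close> meaningful; its properties then propagate along the sequence by
    induction.\<close>
  have evolvent: "equiangular_hedgehog n (Q (Suc k)) \<and> perimeter n (Q (Suc k)) = 0 \<and>
      A_evolute (Q (Suc k)) = Q k"
    if "equiangular_hedgehog n (Q k)" "perimeter n (Q k) = 0" for k
    unfolding assms(4) A_evolvent_def using theI'[OF A_evolvent_ex1[OF assms(1) that]] .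
  have Q: "equiangular_hedgehog n (Q k)" "perimeter n (Q k) = 0" for k
    by (induction k) (use assms evolvent in auto)
  have Q_Suc: "A_evolute (Q (Suc k)) = Q k" for k using evolvent Q by blast
  have centroid: "vertex_centroid n (Q k) = C" for k
  proof (induction k)
    case (Suc k)
    thus ?case using vertex_centroid_A_evolute[OF assms(1), of "Q (Suc k)"] Q Q_Suc by simp
  qed (simp add: C_def)
  have u: "(\<lambda>k. offset_from C (Q k j)) \<longlonglongrightarrow> 0" for j
  proof (rule iterated_antidifference_tendsto_0)
    fix k j
    show "offset_from C (Q k (j + int n)) = offset_from C (Q k j)"
      by (simp add: equiangular_periodic[OF Q(1)])
    show "offset_from C (Q (Suc k) (j + 1)) - offset_from C (Q (Suc k) j) =
        2 * sin (pi / real n) * offset_from C (Q k j)"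
      using offset_from_A_evolute[OF assms(1) Q(1)[of "Suc k"]] by (simp add: Q_Suc)
    show "(\<Sum>j = 0..<int n. offset_from C (Q k j)) = 0"
      by (rule sum_offset_from[OF assms(1) Q])
    \<comment> \<open>The mode condition is stated with roots of unity; multiplying by the nonzero
      normal of side 0 turns them into the normals of \<open>Q k\<close>.\<close>
    have "conormal (Q k 0) *
        (\<Sum>j = 0..<int n. offset_from C (Q k j) * cis (2 * pi * of_int j / real n)) =
        (\<Sum>j = 0..<int n. offset_from C (Q k j) * conormal (Q k j))"
      unfolding sum_distrib_left
      by (intro sum.cong refl) (subst equiangular_conormal[OF Q(1)], simp only: mult_ac)
    also have "\<dots> = 0"
      using sum_offset_from_centroid_conormal[OF assms(1) Q(1)] by (simp add: centroid)
    finally show "(\<Sum>j = 0..<int n. offset_from C (Q k j) * cis (2 * pi * of_int j / real n)) = 0"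
      unfolding mult_eq_0_iff by (simp only: conormal_neq_0 simp_thms)
  qed (use assms(1) in simp)
  \<comment> \<open>\<open>D k\<close> is the vertex seen from \<open>C\<close> in the frame of its
    side. That frame keeps turning with \<open>k\<close>, so the comparison with the vertex is made
    through norms, which the unit normal does not change.\<close>
  define D where "D = (\<lambda>k. Complex (offset_from C (Q k j))
    ((offset_from C (Q k (j + 1)) - offset_from C (Q k j) * cos \<theta>) / sin \<theta>))"
  have "D \<longlonglongrightarrow> Complex 0 ((0 - 0 * cos \<theta>) / sin \<theta>)"
    unfolding D_def
    using sin_2pi_div_pos[OF assms(1)] by (intro tendsto_Complex tendsto_intros u) (simp add: \<theta>_def)
  hence "(\<lambda>k. norm (D k)) \<longlonglongrightarrow> 0" by (intro tendsto_norm_zero) (simp add: Complex_eq)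
  moreover have "norm (vertex (Q k) j - C) = norm (D k)" for k
    unfolding vertex_diff[OF assms(1) Q(1)] by (simp add: norm_mult D_def \<theta>_def)
  ultimately have "(\<lambda>k. norm (vertex (Q k) j - C)) \<longlonglongrightarrow> 0" by simp
  thus "(\<lambda>k. vertex (Q k) j) \<longlonglongrightarrow> vertex_centroid n (Q 0)"
    unfolding C_def[symmetric] by (rule LIM_zero_cancel[OF tendsto_norm_zero_cancel])
qed

end
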